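(* Let $R\subset E$ be an extension of Rota-Baxter family Hom-associative algebras of weight $\lambda$, with a linear retraction $\rho:E\to R$ (a linear map with $\rho(a)=a$ for all $a\in R$), $V=\ker\rho$, and let $\Omega(R,V)=\Upsilon_1(E)$ be the associated Rota-Baxter family Hom extending structure of $R$ through $V$. Let $\mathcal{C}(R,E)$ be the set of all Rota-Baxter family Hom complements of $R$ in $E$, $\mathcal{D}(R,V)$ the set of all deformation maps of $\Omega(R,V)$, and $\Delta_1:\mathcal{C}(R,E)\to\mathcal{D}(R,V)$, $B\mapsto d:=-\tilde d|_V$, where $\tilde d:E\to R$ is the retraction associated to $B$, i.e. $\tilde d(a+b)=a$ for $a\in R$, $b\in B$. Then $\Delta_1$ induces a bijection of equivalence classes $$\Delta:CH^2(R,E):=\mathcal{C}(R,E)/\!\cong\ \longrightarrow\ H^2(R,V):=\mathcal{D}(R,V)/\!\sim,\qquad [B]\mapsto[d].$$ In particular, the index of $R$ in $E$ is given by $[E:R]=|H^2(R,V)|$.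
   Context: Fix a field $\mathbf{k}$, a semigroup $S$ and $\lambda\in\mathbf{k}$. All vector spaces and (bi)linear maps are over $\mathbf{k}$; families are indexed by $\omega\in S$. A Rota-Baxter family Hom-associative algebra (of weight $\lambda$) is a 4-tuple $(R,\cdot,(P_\omega)_{\omega\in S},\theta)$, with $R$ a vector space, $\cdot:R\times R\to R$ bilinear, $P_\omega:R\to R$ ($\omega\in S$) and $\theta:R\to R$ linear, such that for all $x,y,z\in R$ and $\omega,\alpha,\beta\in S$: $\theta(x)\cdot(y\cdot z)=(x\cdot y)\cdot\theta(z)$; $P_\alpha(x)\cdot P_\beta(y)=P_{\alpha\beta}(P_\alpha(x)\cdot y+x\cdot P_\beta(y)+\lambda\,x\cdot y)$; $P_\omega(\theta(x))=\theta(P_\omega(x))$. Morphisms are linear maps commuting with the products, with $P_\omega$ for each $\omega\in S$, and with $\theta$; isomorphisms ($\cong$) are bijective morphisms. $R\subset E$ is an extension if $R=(R,\cdot,(P_\omega),\theta)$ is a subalgebra of $E=(E,\cdot_E,(P_{\omega,E}),\theta_E)$, i.e. a subspace on which $\cdot_E,P_{\omega,E},\theta_E$ restrict to $\cdot,P_\omega,\theta$. A Rota-Baxter family Hom complement of $R$ in $E$ is a subalgebra $B$ of $E$ (a subspace closed under $\cdot_E$, all $P_{\omega,E}$ and $\theta_E$) with $E=R+B$ and $R\cap B=\{0\}$. $\mathcal{C}(R,E)/\!\cong$ is the set of isomorphism classes of such complements (as Rota-Baxter family Hom-associative algebras), and the index $[E:R]$ is its cardinality. An extending datum of $R$ through a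 vector space $V$ is a system $\Omega(R,V)=(\triangleright,\triangleleft,\rightharpoonup,\leftharpoonup,f,\cdot_V,(Q_\omega),(P_{\omega,V}),\eta,\theta_V)$ of bilinear maps $\triangleright:R\times V\to V$, $\triangleleft:V\times R\to V$, $\rightharpoonup:V\times R\to R$, $\leftharpoonup:R\times V\to R$, $f:V\times V\to R$, $\cdot_V:V\times V\to V$ and linear maps $Q_\omega:V\to R$, $P_{\omega,V}:V\to V$, $\eta:V\to R$, $\theta_V:V\to V$. It is a Rota-Baxter family Hom extending structure if $R\times V$ with $(a,x)\,\bar\cdot\,(b,y)=(ab+a\leftharpoonup y+x\rightharpoonup b+f(x,y),\ a\triangleright y+x\triangleleft b+x\cdot_V y)$, $\bar P_\omega(a,x)=(P_\omega(a)+Q_\omega(x),P_{\omega,V}(x))$, $\bar\theta(a,x)=(\theta(a)+\eta(x),\theta_V(x))$ is a Rota-Baxter family Hom-associative algebra of weight $\lambda$. The Rota-Baxter family Hom extending structure $\Upsilon_1(E)$ associated with $E$ and $\rho$ is given, for $a\in R$, $x,y\in V=\ker\rho$, by $a\triangleright x=a\cdot_E x-\rho(a\cdot_E x)$, $x\triangleleft a=x\cdot_E a-\rho(x\cdot_E a)$, $a\leftharpoonup x=\rho(a\cdot_E x)$, $x\rightharpoonup a=\rho(x\cdot_E a)$, $f(x,y)=\rho(x\cdot_E y)$, $x\cdot_V y=x\cdot_E y-\rho(x\cdot_E y)$, $Q_\omega(x)=\rho(P_{\omega,E}(x))$, $P_{\omega,V}(x)=P_{\omega,E}(x)-\rho(P_{\omega,E}(x))$,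 $\eta(x)=\rho(\theta_E(x))$, $\theta_V(x)=\theta_E(x)-\rho(\theta_E(x))$. A deformation map of $\Omega(R,V)$ is a linear map $d:V\to R$ such that for all $x,y\in V$ and $\omega\in S$: $d(x)d(y)-d(x\cdot_V y)=d(d(x)\triangleright y+x\triangleleft d(y))-d(x)\leftharpoonup y-x\rightharpoonup d(y)-f(x,y)$; $d(P_{\omega,V}(x))=Q_\omega(x)+P_\omega(d(x))$; $d(\theta_V(x))=\eta(x)+\theta(d(x))$. Two deformation maps $d,D:V\to R$ are equivalent ($d\sim D$) if there is a linear automorphism $\delta:V\to V$ such that for all $x,y\in V$, $\omega\in S$: $\delta(x\cdot_V y)-\delta(x)\cdot_V\delta(y)=D(\delta(x))\triangleright\delta(y)+\delta(x)\triangleleft D(\delta(y))-\delta(d(x)\triangleright y)-\delta(x\triangleleft d(y))$; $\delta(P_{\omega,V}(x))=P_{\omega,V}(\delta(x))$; $\delta(\theta_V(x))=\theta_V(\delta(x))$. This is an equivalence relation. *)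

theory Defs
  imports "HOL-Analysis.Product_Vector" "HOL-Library.FuncSet"
begin

text \<open>
  All vector spaces are subspaces, in the sense of the library locale \<^locale>\<open>vector_space\<close>, of an
  ambient type with an explicit scalar multiplication.  The components of the records below are
  meaningful on the carriers only.
\<close>

definition linear_on ::
  "('k \<Rightarrow> 'a::ab_group_add \<Rightarrow> 'a) \<Rightarrow> ('k \<Rightarrow> 'b::ab_group_add \<Rightarrow> 'b) \<Rightarrow> 'a set \<Rightarrow> 'b set \<Rightarrow> ('a \<Rightarrow> 'b) \<Rightarrow> bool"
  where "linear_on sA sB A B f \<longleftrightarrow>
    f \<in> A \<rightarrow> B \<and>
    (\<forall>x\<in>A. \<forall>y\<in>A. f (x + y) = f x + f y) \<and>
    (\<forall>c. \<forall>x\<in>A. f (sA c x) = sB c (f x))"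

definition bilinear_on ::
  "('k \<Rightarrow> 'a::ab_group_add \<Rightarrow> 'a) \<Rightarrow> ('k \<Rightarrow> 'b::ab_group_add \<Rightarrow> 'b) \<Rightarrow> ('k \<Rightarrow> 'c::ab_group_add \<Rightarrow> 'c)
    \<Rightarrow> 'a set \<Rightarrow> 'b set \<Rightarrow> 'c set \<Rightarrow> ('a \<Rightarrow> 'b \<Rightarrow> 'c) \<Rightarrow> bool"
  where "bilinear_on sA sB sC A B C f \<longleftrightarrow>
    (\<forall>x\<in>A. linear_on sB sC B C (\<lambda>y. f x y)) \<and>
    (\<forall>y\<in>B. linear_on sA sC A C (\<lambda>x. f x y))"


section \<open>Rota-Baxter family Hom-associative algebras\<close>

record ('s, 'a) rbfh =
  carrier :: "'a set"
  mult :: "'a \<Rightarrow> 'a \<Rightarrow> 'a"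
  rbop :: "'s \<Rightarrow> 'a \<Rightarrow> 'a"
  twist :: "'a \<Rightarrow> 'a"

locale rbfh_algebra = vector_space smul
  for smul :: "'k::field \<Rightarrow> 'a::ab_group_add \<Rightarrow> 'a" +
  fixes lam :: 'k and A :: "('s::semigroup_mult, 'a) rbfh"
  assumes subspace_carrier: "subspace (carrier A)"
    and bilinear_mult:
      "bilinear_on smul smul smul (carrier A) (carrier A) (carrier A) (mult A)"
    and linear_rbop: "linear_on smul smul (carrier A) (carrier A) (rbop A w)"
    and linear_twist: "linear_on smul smul (carrier A) (carrier A) (twist A)"
    and hom_assoc: "\<lbrakk>x \<in> carrier A; y \<in> carrier A; z \<in> carrier A\<rbrakk> \<Longrightarrow>
      mult A (twist A x) (mult A y z) = mult A (mult A x y) (twist A z)"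
    and rota_baxter: "\<lbrakk>x \<in> carrier A; y \<in> carrier A\<rbrakk> \<Longrightarrow>
      mult A (rbop A \<alpha> x) (rbop A \<beta> y) =
      rbop A (\<alpha> * \<beta>) (mult A (rbop A \<alpha> x) y + mult A x (rbop A \<beta> y) + smul lam (mult A x y))"
    and rbop_twist: "x \<in> carrier A \<Longrightarrow> rbop A w (twist A x) = twist A (rbop A w x)"

definition rbfh_hom ::
  "('k::field \<Rightarrow> 'a::ab_group_add \<Rightarrow> 'a) \<Rightarrow> ('k \<Rightarrow> 'b::ab_group_add \<Rightarrow> 'b)
    \<Rightarrow> ('s, 'a) rbfh \<Rightarrow> ('s, 'b) rbfh \<Rightarrow> ('a \<Rightarrow> 'b) set"
  where "rbfh_hom sA sB A B = {\<phi>.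
    linear_on sA sB (carrier A) (carrier B) \<phi> \<and>
    (\<forall>x\<in>carrier A. \<forall>y\<in>carrier A. \<phi> (mult A x y) = mult B (\<phi> x) (\<phi> y)) \<and>
    (\<forall>w. \<forall>x\<in>carrier A. \<phi> (rbop A w x) = rbop B w (\<phi> x)) \<and>
    (\<forall>x\<in>carrier A. \<phi> (twist A x) = twist B (\<phi> x))}"

definition rbfh_isomorphic ::
  "('k::field \<Rightarrow> 'a::ab_group_add \<Rightarrow> 'a) \<Rightarrow> ('k \<Rightarrow> 'b::ab_group_add \<Rightarrow> 'b)
    \<Rightarrow> ('s, 'a) rbfh \<Rightarrow> ('s, 'b) rbfh \<Rightarrow> bool"
  where "rbfh_isomorphic sA sB A B \<longleftrightarrow>
    (\<exists>\<phi>\<in>rbfh_hom sA sB A B. bij_betw \<phi> (carrier A) (carrier B))"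

definition subalgebra ::
  "('k::field \<Rightarrow> 'a::ab_group_add \<Rightarrow> 'a) \<Rightarrow> ('s, 'a) rbfh \<Rightarrow> 'a set \<Rightarrow> bool"
  where "subalgebra smul E B \<longleftrightarrow>
    B \<subseteq> carrier E \<and> module.subspace smul B \<and>
    (\<forall>x\<in>B. \<forall>y\<in>B. mult E x y \<in> B) \<and>
    (\<forall>w. \<forall>x\<in>B. rbop E w x \<in> B) \<and>
    (\<forall>x\<in>B. twist E x \<in> B)"

definition restrict_alg :: "('s, 'a) rbfh \<Rightarrow> 'a set \<Rightarrow> ('s, 'a) rbfh"
  where "restrict_alg E B = E\<lparr>carrier := B\<rparr>"

definition rbfh_extension ::
  "('k::field \<Rightarrow> 'a::ab_group_add \<Rightarrow> 'a) \<Rightarrow> 'k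
    \<Rightarrow> ('s::semigroup_mult, 'a) rbfh \<Rightarrow> ('s, 'a) rbfh \<Rightarrow> bool"
  where "rbfh_extension smul lam R E \<longleftrightarrow>
    rbfh_algebra smul lam R \<and> rbfh_algebra smul lam E \<and>
    subalgebra smul E (carrier R) \<and>
    (\<forall>a\<in>carrier R. \<forall>b\<in>carrier R. mult E a b = mult R a b) \<and>
    (\<forall>w. \<forall>a\<in>carrier R. rbop E w a = rbop R w a) \<and>
    (\<forall>a\<in>carrier R. twist E a = twist R a)"


section \<open>Complements\<close>

definition complements ::
  "('k::field \<Rightarrow> 'a::ab_group_add \<Rightarrow> 'a) \<Rightarrow> ('s, 'a) rbfh \<Rightarrow> ('s, 'a) rbfh \<Rightarrow> 'a set set"
  where "complements smul R E = {B.
    subalgebra smul E B \<and>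
    carrier E = {a + b | a b. a \<in> carrier R \<and> b \<in> B} \<and>
    carrier R \<inter> B = {0}}"

definition complement_iso ::
  "('k::field \<Rightarrow> 'a::ab_group_add \<Rightarrow> 'a) \<Rightarrow> ('s, 'a) rbfh \<Rightarrow> ('s, 'a) rbfh \<Rightarrow> ('a set \<times> 'a set) set"
  where "complement_iso smul R E = {(B, B').
    B \<in> complements smul R E \<and> B' \<in> complements smul R E \<and>
    rbfh_isomorphic smul smul (restrict_alg E B) (restrict_alg E B')}"

definition CH2 ::
  "('k::field \<Rightarrow> 'a::ab_group_add \<Rightarrow> 'a) \<Rightarrow> ('s, 'a) rbfh \<Rightarrow> ('s, 'a) rbfh \<Rightarrow> 'a set set set"
  where "CH2 smul R E = complements smul R E // complement_iso smul R E"

text \<open>The index is a cardinal, possibly infinite; cardinals are compared by \<^const>\<open>ordIso\<close>.\<close>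

definition rbfh_index ::
  "('k::field \<Rightarrow> 'a::ab_group_add \<Rightarrow> 'a) \<Rightarrow> ('s, 'a) rbfh \<Rightarrow> ('s, 'a) rbfh \<Rightarrow> 'a set set rel"
  where "rbfh_index smul R E = card_of (CH2 smul R E)"


section \<open>Extending structures\<close>

record ('s, 'r, 'v) ext_datum =
  actl :: "'r \<Rightarrow> 'v \<Rightarrow> 'v"  (* a \<triangleright> x *)
  actr :: "'v \<Rightarrow> 'r \<Rightarrow> 'v"  (* x \<triangleleft> a *)
  coactl :: "'v \<Rightarrow> 'r \<Rightarrow> 'r"  (* x \<rightharpoonup> a *)
  coactr :: "'r \<Rightarrow> 'v \<Rightarrow> 'r"  (* a \<leftharpoonup> x *)
  cocyc :: "'v \<Rightarrow> 'v \<Rightarrow> 'r"  (* f(x, y) *)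
  multV :: "'v \<Rightarrow> 'v \<Rightarrow> 'v"
  Qop :: "'s \<Rightarrow> 'v \<Rightarrow> 'r"
  PV :: "'s \<Rightarrow> 'v \<Rightarrow> 'v"
  etaV :: "'v \<Rightarrow> 'r"
  thetaV :: "'v \<Rightarrow> 'v"

definition extending_datum ::
  "('k::field \<Rightarrow> 'r::ab_group_add \<Rightarrow> 'r) \<Rightarrow> ('k \<Rightarrow> 'v::ab_group_add \<Rightarrow> 'v)
    \<Rightarrow> 'r set \<Rightarrow> 'v set \<Rightarrow> ('s, 'r, 'v) ext_datum \<Rightarrow> bool"
  where "extending_datum sR sV R V \<Omega> \<longleftrightarrow>
    bilinear_on sR sV sV R V V (actl \<Omega>) \<and>
    bilinear_on sV sR sV V R V (actr \<Omega>) \<and>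
    bilinear_on sV sR sR V R R (coactl \<Omega>) \<and>
    bilinear_on sR sV sR R V R (coactr \<Omega>) \<and>
    bilinear_on sV sV sR V V R (cocyc \<Omega>) \<and>
    bilinear_on sV sV sV V V V (multV \<Omega>) \<and>
    (\<forall>w. linear_on sV sR V R (Qop \<Omega> w)) \<and>
    (\<forall>w. linear_on sV sV V V (PV \<Omega> w)) \<and>
    linear_on sV sR V R (etaV \<Omega>) \<and>
    linear_on sV sV V V (thetaV \<Omega>)"

definition unified_product ::
  "('s, 'r::ab_group_add) rbfh \<Rightarrow> 'v::ab_group_add set \<Rightarrow> ('s, 'r, 'v) ext_datum \<Rightarrow> ('s, 'r \<times> 'v) rbfh"
  where "unified_product R V \<Omega> = \<lparr>
    carrier = carrier R \<times> V,
    mult = (\<lambda>(a, x) (b, y).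
      (mult R a b + coactr \<Omega> a y + coactl \<Omega> x b + cocyc \<Omega> x y,
       actl \<Omega> a y + actr \<Omega> x b + multV \<Omega> x y)),
    rbop = (\<lambda>w (a, x). (rbop R w a + Qop \<Omega> w x, PV \<Omega> w x)),
    twist = (\<lambda>(a, x). (twist R a + etaV \<Omega> x, thetaV \<Omega> x))\<rparr>"

definition extending_structure ::
  "('k::field \<Rightarrow> 'r::ab_group_add \<Rightarrow> 'r) \<Rightarrow> ('k \<Rightarrow> 'v::ab_group_add \<Rightarrow> 'v) \<Rightarrow> 'k
    \<Rightarrow> ('s::semigroup_mult, 'r) rbfh \<Rightarrow> 'v set \<Rightarrow> ('s, 'r, 'v) ext_datum \<Rightarrow> bool"
  where "extending_structure sR sV lam R V \<Omega> \<longleftrightarrow>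
    extending_datum sR sV (carrier R) V \<Omega> \<and>
    rbfh_algebra (module_prod.scale sR sV) lam (unified_product R V \<Omega>)"

definition linear_retraction ::
  "('k::field \<Rightarrow> 'a::ab_group_add \<Rightarrow> 'a) \<Rightarrow> ('s, 'a) rbfh \<Rightarrow> ('s, 'a) rbfh \<Rightarrow> ('a \<Rightarrow> 'a) \<Rightarrow> bool"
  where "linear_retraction smul R E \<rho> \<longleftrightarrow>
    linear_on smul smul (carrier E) (carrier R) \<rho> \<and> (\<forall>a\<in>carrier R. \<rho> a = a)"

definition retraction_kernel :: "('s, 'a::ab_group_add) rbfh \<Rightarrow> ('a \<Rightarrow> 'a) \<Rightarrow> 'a set"
  where "retraction_kernel E \<rho> = {x \<in> carrier E. \<rho> x = 0}"

definition Upsilon1 :: "('s, 'a::ab_group_add) rbfh \<Rightarrow> ('a \<Rightarrow> 'a) \<Rightarrow> ('s, 'a, 'a) ext_datum"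
  where "Upsilon1 E \<rho> = \<lparr>
    actl = (\<lambda>a x. mult E a x - \<rho> (mult E a x)),
    actr = (\<lambda>x a. mult E x a - \<rho> (mult E x a)),
    coactl = (\<lambda>x a. \<rho> (mult E x a)),
    coactr = (\<lambda>a x. \<rho> (mult E a x)),
    cocyc = (\<lambda>x y. \<rho> (mult E x y)),
    multV = (\<lambda>x y. mult E x y - \<rho> (mult E x y)),
    Qop = (\<lambda>w x. \<rho> (rbop E w x)),
    PV = (\<lambda>w x. rbop E w x - \<rho> (rbop E w x)),
    etaV = (\<lambda>x. \<rho> (twist E x)),
    thetaV = (\<lambda>x. twist E x - \<rho> (twist E x))\<rparr>"


section \<open>Deformation maps\<close>

text \<open>
  Maps on \<open>V\<close> are extensional functions, so that two deformation maps are equal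
  as soon as they agree on \<open>V\<close>.
\<close>

definition deformation_maps ::
  "('k::field \<Rightarrow> 'r::ab_group_add \<Rightarrow> 'r) \<Rightarrow> ('k \<Rightarrow> 'v::ab_group_add \<Rightarrow> 'v)
    \<Rightarrow> ('s, 'r) rbfh \<Rightarrow> 'v set \<Rightarrow> ('s, 'r, 'v) ext_datum \<Rightarrow> ('v \<Rightarrow> 'r) set"
  where "deformation_maps sR sV R V \<Omega> = {d \<in> V \<rightarrow>\<^sub>E carrier R.
    linear_on sV sR V (carrier R) d \<and>
    (\<forall>x\<in>V. \<forall>y\<in>V.
      mult R (d x) (d y) - d (multV \<Omega> x y) =
      d (actl \<Omega> (d x) y + actr \<Omega> x (d y)) - coactr \<Omega> (d x) y - coactl \<Omega> x (d y) - cocyc \<Omega> x y) \<and>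
    (\<forall>w. \<forall>x\<in>V. d (PV \<Omega> w x) = Qop \<Omega> w x + rbop R w (d x)) \<and>
    (\<forall>x\<in>V. d (thetaV \<Omega> x) = etaV \<Omega> x + twist R (d x))}"

definition deformation_equiv ::
  "('k::field \<Rightarrow> 'r::ab_group_add \<Rightarrow> 'r) \<Rightarrow> ('k \<Rightarrow> 'v::ab_group_add \<Rightarrow> 'v)
    \<Rightarrow> ('s, 'r) rbfh \<Rightarrow> 'v set \<Rightarrow> ('s, 'r, 'v) ext_datum \<Rightarrow> (('v \<Rightarrow> 'r) \<times> ('v \<Rightarrow> 'r)) set"
  where "deformation_equiv sR sV R V \<Omega> = {(d, D).
    d \<in> deformation_maps sR sV R V \<Omega> \<and> D \<in> deformation_maps sR sV R V \<Omega> \<and>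
    (\<exists>\<delta>. linear_on sV sV V V \<delta> \<and> bij_betw \<delta> V V \<and>
      (\<forall>x\<in>V. \<forall>y\<in>V.
        \<delta> (multV \<Omega> x y) - multV \<Omega> (\<delta> x) (\<delta> y) =
        actl \<Omega> (D (\<delta> x)) (\<delta> y) + actr \<Omega> (\<delta> x) (D (\<delta> y))
          - \<delta> (actl \<Omega> (d x) y) - \<delta> (actr \<Omega> x (d y))) \<and>
      (\<forall>w. \<forall>x\<in>V. \<delta> (PV \<Omega> w x) = PV \<Omega> w (\<delta> x)) \<and>
      (\<forall>x\<in>V. \<delta> (thetaV \<Omega> x) = thetaV \<Omega> (\<delta> x)))}"

definition H2 ::
  "('k::field \<Rightarrow> 'r::ab_group_add \<Rightarrow> 'r) \<Rightarrow> ('k \<Rightarrow> 'v::ab_group_add \<Rightarrow> 'v)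
    \<Rightarrow> ('s, 'r) rbfh \<Rightarrow> 'v set \<Rightarrow> ('s, 'r, 'v) ext_datum \<Rightarrow> ('v \<Rightarrow> 'r) set set"
  where "H2 sR sV R V \<Omega> = deformation_maps sR sV R V \<Omega> // deformation_equiv sR sV R V \<Omega>"

definition complement_retraction :: "('s, 'a::ab_group_add) rbfh \<Rightarrow> 'a set \<Rightarrow> 'a \<Rightarrow> 'a"
  where "complement_retraction R B e = (THE a. a \<in> carrier R \<and> (\<exists>b\<in>B. e = a + b))"

definition Delta1 :: "('s, 'a::ab_group_add) rbfh \<Rightarrow> 'a set \<Rightarrow> 'a set \<Rightarrow> 'a \<Rightarrow> 'a"
  where "Delta1 R V B = (\<lambda>x\<in>V. - complement_retraction R B x)"


section \<open>Well-definedness\<close>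

text \<open>The two relations are equivalence relations, and \<^const>\<open>Upsilon1\<close> is an extending structure.\<close>

lemma linear_on_mem: "linear_on sA sB A B f \<Longrightarrow> x \<in> A \<Longrightarrow> f x \<in> B"
  and linear_on_add: "linear_on sA sB A B f \<Longrightarrow> x \<in> A \<Longrightarrow> y \<in> A \<Longrightarrow> f (x + y) = f x + f y"
  and linear_on_scale: "linear_on sA sB A B f \<Longrightarrow> x \<in> A \<Longrightarrow> f (sA c x) = sB c (f x)"
  by (auto simp: linear_on_def)

lemma bilinear_on_mem: "bilinear_on sA sB sC A B C f \<Longrightarrow> x \<in> A \<Longrightarrow> y \<in> B \<Longrightarrow> f x y \<in> C"
  by (auto simp: bilinear_on_def linear_on_def)

lemma linear_on_inv:
  assumes f: "linear_on sA sB A B f" and bij: "bij_betw f A B"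
    and add: "\<And>x y. x \<in> A \<Longrightarrow> y \<in> A \<Longrightarrow> x + y \<in> A" and scl: "\<And>c x. x \<in> A \<Longrightarrow> sA c x \<in> A"
  shows "linear_on sB sA B A (inv_into A f)"
proof -
  have m: "inv_into A f y \<in> A" "f (inv_into A f y) = y" if "y \<in> B" for y
    using bij that by (auto simp: bij_betw_def inv_into_into f_inv_into_f)
  have u: "inv_into A f (f x) = x" if "x \<in> A" for x
    using bij that by (simp add: bij_betw_def)
  have "inv_into A f (x + y) = inv_into A f x + inv_into A f y" if "x \<in> B" "y \<in> B" for x y
    using u[OF add[OF m(1)[OF that(1)] m(1)[OF that(2)]]] that
    by (simp add: linear_on_add[OF f] m)
  moreover have "inv_into A f (sB c x) = sA c (inv_into A f x)" if "x \<in> B" for c x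
    using u[OF scl[OF m(1)[OF that]], of c] that by (simp add: linear_on_scale[OF f] m)
  ultimately show ?thesis using m by (auto simp: linear_on_def)
qed

lemma (in vector_space) linear_on_diff:
  assumes "linear_on smul sB A B f" "subspace A" "x \<in> A" "y \<in> A"
  shows "f (x - y) = f x - f y"
  using linear_on_add[OF assms(1) subspace_diff[OF assms(2-4)] assms(4)] by (simp add: algebra_simps)

theorem equiv_complement_iso:
  assumes "vector_space smul"
  shows "equiv (complements smul R E) (complement_iso smul R E)"
proof (rule equivI)
  interpret vector_space smul by fact
  let ?r = "complement_iso smul R E"
  show "?r \<subseteq> complements smul R E \<times> complements smul R E"
    by (auto simp: complement_iso_def)
  show "refl_on (complements smul R E) ?r"
    unfolding refl_on_def complement_iso_def rbfh_isomorphic_def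
    by (auto intro!: bexI[of _ "\<lambda>x. x"] simp: rbfh_hom_def linear_on_def bij_betw_def inj_on_def)
  show "sym ?r"
  proof (rule symI)
    fix B C assume "(B, C) \<in> ?r"
    then have BC: "B \<in> complements smul R E" "C \<in> complements smul R E"
      and "rbfh_isomorphic smul smul (restrict_alg E B) (restrict_alg E C)"
      by (auto simp: complement_iso_def)
    then obtain f where bij: "bij_betw f B C" and lin: "linear_on smul smul B C f"
      and hm: "\<forall>x\<in>B. \<forall>y\<in>B. f (mult E x y) = mult E (f x) (f y)"
      and hr: "\<forall>w. \<forall>x\<in>B. f (rbop E w x) = rbop E w (f x)"
      and ht: "\<forall>x\<in>B. f (twist E x) = twist E (f x)"
      by (auto simp: rbfh_isomorphic_def rbfh_hom_def restrict_alg_def)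
    let ?g = "inv_into B f"
    have sB: "subalgebra smul E B" using BC by (simp add: complements_def)
    then have sub: "subspace B" by (simp add: subalgebra_def)
    have m: "?g y \<in> B" "f (?g y) = y" if "y \<in> C" for y
      using bij that by (auto simp: bij_betw_def inv_into_into f_inv_into_f)
    have u: "?g (f x) = x" if "x \<in> B" for x
      using bij that by (simp add: bij_betw_def)
    have "?g \<in> rbfh_hom smul smul (restrict_alg E C) (restrict_alg E B)"
      unfolding rbfh_hom_def restrict_alg_def
    proof (simp, intro conjI ballI allI)
      show "linear_on smul smul C B ?g"
        by (rule linear_on_inv[OF lin bij]) (auto intro: subspace_add subspace_scale sub)
      show "?g (mult E x y) = mult E (?g x) (?g y)" if "x \<in> C" "y \<in> C" for x y
        using u[of "mult E (?g x) (?g y)"] hm m that sB by (simp add: subalgebra_def)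
      show "?g (rbop E w x) = rbop E w (?g x)" if "x \<in> C" for w x
        using u[of "rbop E w (?g x)"] hr m that sB by (simp add: subalgebra_def)
      show "?g (twist E x) = twist E (?g x)" if "x \<in> C" for x
        using u[of "twist E (?g x)"] ht m that sB by (simp add: subalgebra_def)
    qed
    moreover have "bij_betw ?g C B" by (rule bij_betw_inv_into[OF bij])
    ultimately show "(C, B) \<in> ?r"
      using BC by (auto simp: complement_iso_def rbfh_isomorphic_def restrict_alg_def)
  qed
  show "trans ?r"
  proof (rule transI)
    fix B C D assume "(B, C) \<in> ?r" "(C, D) \<in> ?r"
    then obtain f g where *: "B \<in> complements smul R E" "C \<in> complements smul R E"
        "D \<in> complements smul R E"
        "f \<in> rbfh_hom smul smul (restrict_alg E B) (restrict_alg E C)" "bij_betw f B C"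
        "g \<in> rbfh_hom smul smul (restrict_alg E C) (restrict_alg E D)" "bij_betw g C D"
      by (auto simp: complement_iso_def rbfh_isomorphic_def restrict_alg_def)
    have "g \<circ> f \<in> rbfh_hom smul smul (restrict_alg E B) (restrict_alg E D)"
      using *(4,6) by (auto simp: rbfh_hom_def linear_on_def restrict_alg_def Pi_iff)
    with * show "(B, D) \<in> ?r"
      using bij_betw_trans[OF *(5,7)]
      by (auto simp: complement_iso_def rbfh_isomorphic_def restrict_alg_def)
  qed
qed

theorem equiv_deformation_equiv:
  assumes "vector_space sV" and sub: "module.subspace sV V"
    and \<Omega>: "extending_datum sR sV (carrier R) V \<Omega>"
  shows "equiv (deformation_maps sR sV R V \<Omega>) (deformation_equiv sR sV R V \<Omega>)"
proof (rule equivI)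
  interpret vector_space sV by fact
  let ?D = "deformation_maps sR sV R V \<Omega>"
  let ?r = "deformation_equiv sR sV R V \<Omega>"
  have dm: "d x \<in> carrier R" if "d \<in> ?D" "x \<in> V" for d x
    using that by (auto simp: deformation_maps_def)
  have cl: "actl \<Omega> a x \<in> V" "actr \<Omega> x a \<in> V"
    if "a \<in> carrier R" "x \<in> V" for a x
    using \<Omega> that unfolding extending_datum_def by (meson bilinear_on_mem linear_on_mem)+
  have clM: "multV \<Omega> x y \<in> V" if "x \<in> V" "y \<in> V" for x y
    using \<Omega> that unfolding extending_datum_def by (meson bilinear_on_mem)
  have clV: "PV \<Omega> w x \<in> V" "thetaV \<Omega> x \<in> V" if "x \<in> V" for x w
    using \<Omega> that unfolding extending_datum_def by (meson linear_on_mem)+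
  show "?r \<subseteq> ?D \<times> ?D" by (auto simp: deformation_equiv_def)
  show "refl_on ?D ?r"
    unfolding refl_on_def deformation_equiv_def
    by (auto intro!: exI[of _ "\<lambda>x. x"] simp: linear_on_def bij_betw_def inj_on_def)
  show "sym ?r"
  proof (rule symI)
    fix d D assume "(d, D) \<in> ?r"
    then obtain f where dD: "d \<in> ?D" "D \<in> ?D" and lin: "linear_on sV sV V V f"
      and bij: "bij_betw f V V"
      and hm: "\<And>x y. \<lbrakk>x \<in> V; y \<in> V\<rbrakk> \<Longrightarrow> f (multV \<Omega> x y) - multV \<Omega> (f x) (f y) =
        actl \<Omega> (D (f x)) (f y) + actr \<Omega> (f x) (D (f y)) - f (actl \<Omega> (d x) y) - f (actr \<Omega> x (d y))"
      and hP: "\<And>w x. x \<in> V \<Longrightarrow> f (PV \<Omega> w x) = PV \<Omega> w (f x)"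
      and ht: "\<And>x. x \<in> V \<Longrightarrow> f (thetaV \<Omega> x) = thetaV \<Omega> (f x)"
      by (auto simp: deformation_equiv_def)
    let ?g = "inv_into V f"
    have m: "?g y \<in> V" "f (?g y) = y" if "y \<in> V" for y
      using bij that by (auto simp: bij_betw_def inv_into_into f_inv_into_f)
    have u: "?g (f x) = x" if "x \<in> V" for x
      using bij that by (simp add: bij_betw_def)
    have ling: "linear_on sV sV V V ?g"
      by (rule linear_on_inv[OF lin bij]) (auto intro: subspace_add subspace_scale sub)
    have "?g (multV \<Omega> x y) - multV \<Omega> (?g x) (?g y) =
        actl \<Omega> (d (?g x)) (?g y) + actr \<Omega> (?g x) (d (?g y)) - ?g (actl \<Omega> (D x) y) - ?g (actr \<Omega> x (D y))"
      if x: "x \<in> V" and y: "y \<in> V" for x y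
    proof -
      note c = m[OF x] m[OF y] dm[OF dD(1) m(1)[OF x]] dm[OF dD(1) m(1)[OF y]]
        dm[OF dD(2) x] dm[OF dD(2) y] x y
      define p where "p = actl \<Omega> (d (?g x)) (?g y)"
      define q where "q = actr \<Omega> (?g x) (d (?g y))"
      define r where "r = multV \<Omega> (?g x) (?g y)"
      have V: "p \<in> V" "q \<in> V" "r \<in> V" "actl \<Omega> (D x) y \<in> V" "actr \<Omega> x (D y) \<in> V" "multV \<Omega> x y \<in> V"
        using c unfolding p_def q_def r_def by (simp_all add: cl clM)
      have "f r - multV \<Omega> x y = actl \<Omega> (D x) y + actr \<Omega> x (D y) - f p - f q"
        using hm[of "?g x" "?g y"] c unfolding p_def q_def r_def by simp
      then have "multV \<Omega> x y + actl \<Omega> (D x) y + actr \<Omega> x (D y) = f r + f p + f q"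
        by (simp add: algebra_simps)
      also have "\<dots> = f (r + p + q)"
        using V by (simp add: linear_on_add[OF lin] subspace_add sub)
      finally have "?g (multV \<Omega> x y + actl \<Omega> (D x) y + actr \<Omega> x (D y)) = r + p + q"
        using u V by (simp add: subspace_add sub)
      then have "?g (multV \<Omega> x y) + ?g (actl \<Omega> (D x) y) + ?g (actr \<Omega> x (D y)) = r + p + q"
        using V by (simp add: linear_on_add[OF ling] subspace_add sub)
      then show ?thesis unfolding p_def[symmetric] q_def[symmetric] r_def[symmetric]
        by (simp add: algebra_simps)
    qed
    moreover have "?g (PV \<Omega> w x) = PV \<Omega> w (?g x)" if "x \<in> V" for w x
      using u[of "PV \<Omega> w (?g x)"] hP[of "?g x"] m[OF that] clV by simp
    moreover have "?g (thetaV \<Omega> x) = thetaV \<Omega> (?g x)" if "x \<in> V" for x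
      using u[of "thetaV \<Omega> (?g x)"] ht[of "?g x"] m[OF that] clV by simp
    ultimately show "(D, d) \<in> ?r"
      using ling bij_betw_inv_into[OF bij] dD unfolding deformation_equiv_def
      by (auto intro!: exI[of _ ?g])
  qed
  show "trans ?r"
  proof (rule transI)
    fix d D G assume "(d, D) \<in> ?r" "(D, G) \<in> ?r"
    then obtain f g where D: "d \<in> ?D" "D \<in> ?D" "G \<in> ?D" 
      and f: "linear_on sV sV V V f" "bij_betw f V V"
      and hm: "\<And>x y. \<lbrakk>x \<in> V; y \<in> V\<rbrakk> \<Longrightarrow> f (multV \<Omega> x y) - multV \<Omega> (f x) (f y) =
        actl \<Omega> (D (f x)) (f y) + actr \<Omega> (f x) (D (f y)) - f (actl \<Omega> (d x) y) - f (actr \<Omega> x (d y))"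
      and hP: "\<And>w x. x \<in> V \<Longrightarrow> f (PV \<Omega> w x) = PV \<Omega> w (f x)"
      and ht: "\<And>x. x \<in> V \<Longrightarrow> f (thetaV \<Omega> x) = thetaV \<Omega> (f x)"
      and g: "linear_on sV sV V V g" "bij_betw g V V"
      and gm: "\<And>x y. \<lbrakk>x \<in> V; y \<in> V\<rbrakk> \<Longrightarrow> g (multV \<Omega> x y) - multV \<Omega> (g x) (g y) =
        actl \<Omega> (G (g x)) (g y) + actr \<Omega> (g x) (G (g y)) - g (actl \<Omega> (D x) y) - g (actr \<Omega> x (D y))"
      and gP: "\<And>w x. x \<in> V \<Longrightarrow> g (PV \<Omega> w x) = PV \<Omega> w (g x)"
      and gt: "\<And>x. x \<in> V \<Longrightarrow> g (thetaV \<Omega> x) = thetaV \<Omega> (g x)"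
      by (auto simp: deformation_equiv_def)
    note fV = linear_on_mem[OF f(1)]
    have lin: "linear_on sV sV V V (g \<circ> f)"
      using f(1) g(1) by (auto simp: linear_on_def Pi_iff)
    have mul: "(g \<circ> f) (multV \<Omega> x y) - multV \<Omega> ((g \<circ> f) x) ((g \<circ> f) y) =
        actl \<Omega> (G ((g \<circ> f) x)) ((g \<circ> f) y) + actr \<Omega> ((g \<circ> f) x) (G ((g \<circ> f) y))
        - (g \<circ> f) (actl \<Omega> (d x) y) - (g \<circ> f) (actr \<Omega> x (d y))"
      if x: "x \<in> V" and y: "y \<in> V" for x y
    proof -
      define p where "p = f (actl \<Omega> (d x) y)"
      define q where "q = f (actr \<Omega> x (d y))"
      define r where "r = f (multV \<Omega> x y)"
      define p' where "p' = actl \<Omega> (D (f x)) (f y)"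
      define q' where "q' = actr \<Omega> (f x) (D (f y))"
      define r' where "r' = multV \<Omega> (f x) (f y)"
      note c = x y fV[OF x] fV[OF y] dm[OF D(1) x] dm[OF D(1) y]
         dm[OF D(2) fV[OF x]] dm[OF D(2) fV[OF y]]
      have V: "p \<in> V" "q \<in> V" "r \<in> V" "p' \<in> V" "q' \<in> V" "r' \<in> V"
        using c unfolding p_def q_def r_def p'_def q'_def r'_def by (simp_all add: cl clM fV)
      have "r - r' = p' + q' - p - q"
        using hm[OF x y] unfolding p_def q_def r_def p'_def q'_def r'_def .
      then have "r + p + q = r' + p' + q'" by (simp add: algebra_simps)
      then have "g (r + p + q) = g (r' + p' + q')" by simp
      then have "g r + g p + g q = g r' + g p' + g q'"
        using V by (simp add: linear_on_add[OF g(1)] subspace_add sub)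
      moreover have "g r' - multV \<Omega> (g (f x)) (g (f y)) =
          actl \<Omega> (G (g (f x))) (g (f y)) + actr \<Omega> (g (f x)) (G (g (f y))) - g p' - g q'"
        using gm[OF c(3,4)] unfolding p'_def q'_def r'_def .
      ultimately show ?thesis unfolding comp_def p_def[symmetric] q_def[symmetric] r_def[symmetric]
        by (simp add: algebra_simps)
    qed
    show "(d, G) \<in> ?r"
      unfolding deformation_equiv_def
      using D lin mul bij_betw_trans[OF f(2) g(2)] hP gP ht gt fV
      by (auto intro!: exI[of _ "g \<circ> f"])
  qed
qed

theorem extending_structure_Upsilon1:
  fixes smul :: "'k::field \<Rightarrow> 'a::ab_group_add \<Rightarrow> 'a" and R E :: "('s::semigroup_mult, 'a) rbfh"
  assumes ext: "rbfh_extension smul lam R E" and ret: "linear_retraction smul R E \<rho>"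
  shows "extending_structure smul smul lam R (retraction_kernel E \<rho>) (Upsilon1 E \<rho>)"
proof -
  interpret E: rbfh_algebra smul lam E using ext by (simp add: rbfh_extension_def)
  interpret R: rbfh_algebra smul lam R using ext by (simp add: rbfh_extension_def)
  interpret P: module_prod smul smul by unfold_locales
  interpret VP: vector_space_prod smul smul by unfold_locales
  define V where "V = retraction_kernel E \<rho>"
  let ?R = "carrier R" and ?E = "carrier E" and ?\<Omega> = "Upsilon1 E \<rho>"
  let ?U = "unified_product R V ?\<Omega>"
  have RE: "?R \<subseteq> ?E" and VE: "V \<subseteq> ?E"
    using ext by (auto simp: rbfh_extension_def subalgebra_def V_def retraction_kernel_def)
  have opR: "a \<in> ?R \<Longrightarrow> b \<in> ?R \<Longrightarrow> mult R a b = mult E a b"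
    "a \<in> ?R \<Longrightarrow> rbop R w a = rbop E w a" "a \<in> ?R \<Longrightarrow> twist R a = twist E a" for a b w
    using ext by (auto simp: rbfh_extension_def)
  have clR: "a \<in> ?R \<Longrightarrow> b \<in> ?R \<Longrightarrow> mult E a b \<in> ?R"
    "a \<in> ?R \<Longrightarrow> rbop E w a \<in> ?R" "a \<in> ?R \<Longrightarrow> twist E a \<in> ?R" for a b w
    using ext by (auto simp: rbfh_extension_def subalgebra_def)
  have lin: "linear_on smul smul ?E ?R \<rho>" and id: "\<And>a. a \<in> ?R \<Longrightarrow> \<rho> a = a"
    using ret by (auto simp: linear_retraction_def)
  note \<rho>R = linear_on_mem[OF lin]
  note \<rho>add = linear_on_add[OF lin] and \<rho>scale = linear_on_scale[OF lin]
  have \<rho>E: "\<rho> e \<in> ?E" if "e \<in> ?E" for e using \<rho>R RE that by blast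
  have \<rho>diff: "\<rho> (x - y) = \<rho> x - \<rho> y" if "x \<in> ?E" "y \<in> ?E" for x y
    using E.linear_on_diff[OF lin E.subspace_carrier that] .
  have prV: "e - \<rho> e \<in> V" if "e \<in> ?E" for e
    using that by (simp add: V_def retraction_kernel_def \<rho>diff \<rho>E id \<rho>R E.subspace_diff E.subspace_carrier)
  have \<rho>V: "\<rho> x = 0" if "x \<in> V" for x using that by (simp add: V_def retraction_kernel_def)
  have clE: "x \<in> ?E \<Longrightarrow> y \<in> ?E \<Longrightarrow> x + y \<in> ?E" "x \<in> ?E \<Longrightarrow> smul c x \<in> ?E" for c x y
    by (auto intro: E.subspace_add E.subspace_scale E.subspace_carrier)
  have Vsub: "E.subspace V"
    unfolding V_def retraction_kernel_def
    using E.subspace_0[OF E.subspace_carrier] id[OF E.subspace_0[OF R.subspace_carrier]]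
    by (auto simp: E.subspace_def clE \<rho>add \<rho>scale)
  have lins: "linear_on smul smul A ?R (\<lambda>x. \<rho> (f x))" "linear_on smul smul A V (\<lambda>x. f x - \<rho> (f x))"
    if f: "linear_on smul smul ?E ?E f" and A: "A \<subseteq> ?E" for A f
    using f A unfolding linear_on_def
    by (auto simp: Pi_iff subset_iff \<rho>R prV \<rho>add \<rho>scale E.scale_right_diff_distrib)
  note bmem = bilinear_on_mem[OF E.bilinear_mult]
  have bl: "linear_on smul smul ?E ?E (mult E x)" "linear_on smul smul ?E ?E (\<lambda>y. mult E y x)"
    if "x \<in> ?E" for x
    using E.bilinear_mult that by (auto simp: bilinear_on_def)
  have bils: "bilinear_on smul smul smul A B ?R (\<lambda>x y. \<rho> (mult E x y))"
      "bilinear_on smul smul smul A B V (\<lambda>x y. mult E x y - \<rho> (mult E x y))"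
    if "A \<subseteq> ?E" "B \<subseteq> ?E" for A B
    unfolding bilinear_on_def using that by (auto intro!: lins bl)
  have datum: "extending_datum smul smul ?R V ?\<Omega>"
    unfolding extending_datum_def Upsilon1_def
    by (simp add: bils lins RE VE E.linear_rbop E.linear_twist)

  define pr where "pr e = (\<rho> e, e - \<rho> e)" for e
  define F where "F p = fst p + snd p" for p :: "'a \<times> 'a"
  have carU: "carrier ?U = ?R \<times> V" by (simp add: unified_product_def)
  have FE: "F p \<in> ?E" if "p \<in> ?R \<times> V" for p
    using that RE VE by (auto simp: F_def clE subset_iff)
  have prU: "pr e \<in> ?R \<times> V" if "e \<in> ?E" for e using that by (simp add: pr_def \<rho>R prV)
  have Fpr: "F (pr e) = e" for e by (simp add: F_def pr_def)
  have pradd: "pr (x + y) = pr x + pr y" if "x \<in> ?E" "y \<in> ?E" for x y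
    using that by (simp add: pr_def \<rho>add)
  have prscale: "pr (smul c x) = P.scale c (pr x)" if "x \<in> ?E" for x c
    using that by (simp add: pr_def \<rho>scale P.scale_def E.scale_right_diff_distrib)
  have Fadd: "F (p + q) = F p + F q" for p q by (simp add: F_def)
  have Fscale: "F (P.scale c p) = smul c (F p)" for c p
    by (simp add: F_def P.scale_def E.scale_right_distrib)
  note rmem = linear_on_mem[OF E.linear_rbop] and tmem = linear_on_mem[OF E.linear_twist]
  have mU: "mult ?U p q = pr (mult E (F p) (F q))" if pq: "p \<in> ?R \<times> V" "q \<in> ?R \<times> V" for p q
  proof -
    obtain a x b y where p: "p = (a, x)" and q: "q = (b, y)" by (metis surj_pair)
    have c: "a \<in> ?R" "b \<in> ?R" "x \<in> V" "y \<in> V" "a \<in> ?E" "b \<in> ?E" "x \<in> ?E" "y \<in> ?E"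
      using pq p q RE VE by auto
    have "mult E (F p) (F q) = mult E a b + mult E a y + mult E x b + mult E x y"
      using c by (simp add: F_def p q linear_on_add[OF bl(1)] linear_on_add[OF bl(2)] clE algebra_simps)
    then show ?thesis
      using c by (simp add: p q unified_product_def Upsilon1_def pr_def \<rho>add bmem clE opR id clR algebra_simps)
  qed
  have rU: "rbop ?U w p = pr (rbop E w (F p))" and tU: "twist ?U p = pr (twist E (F p))"
    if p: "p \<in> ?R \<times> V" for p w
  proof -
    obtain a x where p': "p = (a, x)" by (metis surj_pair)
    have c: "a \<in> ?R" "x \<in> V" "a \<in> ?E" "x \<in> ?E" using p p' RE VE by auto
    show "rbop ?U w p = pr (rbop E w (F p))" "twist ?U p = pr (twist E (F p))"
      using c linear_on_add[OF E.linear_rbop c(3,4), of w] linear_on_add[OF E.linear_twist c(3,4)]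
      by (simp_all add: p' F_def unified_product_def Upsilon1_def pr_def \<rho>add rmem tmem opR id clR
          algebra_simps)
  qed
  have subU: "P.p.subspace (?R \<times> V)"
    by (rule P.subspace_Times[OF R.subspace_carrier Vsub])
  have linU: "linear_on P.scale P.scale (?R \<times> V) (?R \<times> V) g"
    if f: "linear_on smul smul ?E ?E f" and g: "\<And>p. p \<in> ?R \<times> V \<Longrightarrow> g p = pr (f (F p))" for f g
    unfolding linear_on_def
    using linear_on_mem[OF f] linear_on_add[OF f] linear_on_scale[OF f]
    by (auto simp del: mem_Sigma_iff simp: g prU FE P.p.subspace_add P.p.subspace_scale subU
        Fadd Fscale pradd prscale)
  have "rbfh_algebra P.scale lam ?U"
  proof (intro rbfh_algebra.intro rbfh_algebra_axioms.intro)
    show "vector_space P.scale" by (rule VP.p.vector_space_axioms)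
    show "P.p.subspace (carrier ?U)" using subU carU by simp
    show "bilinear_on P.scale P.scale P.scale (carrier ?U) (carrier ?U) (carrier ?U) (mult ?U)"
      unfolding bilinear_on_def carU
      by (intro conjI ballI linU[OF bl(1)] linU[OF bl(2)]; (rule FE mU)?; assumption)
    show "linear_on P.scale P.scale (carrier ?U) (carrier ?U) (rbop ?U w)" for w
      unfolding carU by (rule linU[OF E.linear_rbop rU])
    show "linear_on P.scale P.scale (carrier ?U) (carrier ?U) (twist ?U)"
      unfolding carU by (rule linU[OF E.linear_twist tU])
  next
    fix p q r assume "p \<in> carrier ?U" "q \<in> carrier ?U" "r \<in> carrier ?U"
    then show "mult ?U (twist ?U p) (mult ?U q r) = mult ?U (mult ?U p q) (twist ?U r)"
      unfolding carU by (simp del: mem_Sigma_iff add: mU tU prU FE Fpr bmem tmem E.hom_assoc)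
  next
    fix p q \<alpha> \<beta> assume pq: "p \<in> carrier ?U" "q \<in> carrier ?U"
    then have *: "mult ?U (rbop ?U \<alpha> p) q + mult ?U p (rbop ?U \<beta> q) + P.scale lam (mult ?U p q)
      = pr (mult E (rbop E \<alpha> (F p)) (F q) + mult E (F p) (rbop E \<beta> (F q)) + smul lam (mult E (F p) (F q)))"
      unfolding carU
      by (simp del: mem_Sigma_iff add: mU rU prU FE Fpr bmem rmem pradd prscale clE)
    show "mult ?U (rbop ?U \<alpha> p) (rbop ?U \<beta> q) = rbop ?U (\<alpha> * \<beta>)
       (mult ?U (rbop ?U \<alpha> p) q + mult ?U p (rbop ?U \<beta> q) + P.scale lam (mult ?U p q))"
      using pq unfolding * carU
      by (simp del: mem_Sigma_iff add: mU rU prU FE Fpr bmem rmem clE E.rota_baxter)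
  next
    fix p w assume "p \<in> carrier ?U"
    then show "rbop ?U w (twist ?U p) = twist ?U (rbop ?U w p)"
      unfolding carU by (simp del: mem_Sigma_iff add: rU tU prU FE Fpr tmem rmem E.rbop_twist)
  qed
  with datum show ?thesis by (simp add: extending_structure_def V_def)
qed

end

(* A complement B of R in E is the graph {d x + x | x \<in> V} of a unique linear map d from V = ker \<rho>
   to R, and e \<in> E lies on this graph iff d (e - \<rho> e) = \<rho> e.  Evaluating this criterion on products,
   on P_w and on \<theta> of elements of the graph gives exactly the equations of a deformation map, so
   complements and deformation maps are in bijection.  Transporting the operations of the graph to V
   along x \<mapsto> d x + x turns isomorphisms of complements into the automorphisms \<delta> of V in the
   definition of the equivalence of deformation maps. *)

theory Submission
  imports Defs
begin

section \<open>Descent of a bijection to quotient sets\<close>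

text \<open>Since the relations match in both directions, \<open>f\<close> maps each class onto a
  whole class, not merely into one. The induced map is therefore direct image, which is injective on
  subsets of \<open>A\<close> and involves no choice of representatives.\<close>

lemma bij_betw_quotient_image:
  assumes r: "equiv A r" and s: "equiv B s" and f: "bij_betw f A B"
    and rel: "\<And>x y. x \<in> A \<Longrightarrow> y \<in> A \<Longrightarrow> (x, y) \<in> r \<longleftrightarrow> (f x, f y) \<in> s"
  shows "bij_betw ((`) f) (A // r) (B // s)"
    and "\<And>x. x \<in> A \<Longrightarrow> f ` (r `` {x}) = s `` {f x}"
proof -
  have sub: "r \<subseteq> A \<times> A" "s \<subseteq> B \<times> B" using r s by (auto simp: equiv_def)
  show cls: "f ` (r `` {x}) = s `` {f x}" if "x \<in> A" for x
  proof
    show "f ` (r `` {x}) \<subseteq> s `` {f x}" using rel that sub by auto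
    show "s `` {f x} \<subseteq> f ` (r `` {x})"
    proof
      fix z assume z: "z \<in> s `` {f x}"
      then obtain y where "y \<in> A" "z = f y" using sub f by (auto simp: bij_betw_def)
      with z rel that show "z \<in> f ` (r `` {x})" by auto
    qed
  qed
  have "A // r \<subseteq> Pow A" using sub by (auto simp: quotient_def)
  moreover have "inj_on ((`) f) (Pow A)"
    using f by (intro inj_on_image) (simp add: bij_betw_def)
  ultimately have "inj_on ((`) f) (A // r)" by (rule inj_on_subset[rotated])
  moreover have "(`) f ` (A // r) = B // s"
  proof -
    have "(`) f ` (A // r) = (\<lambda>x. s `` {f x}) ` A"
      by (auto simp: quotient_def cls image_iff)
    also have "\<dots> = (\<lambda>y. s `` {y}) ` f ` A" by (simp add: image_image)
    also have "\<dots> = B // s" using f by (auto simp: bij_betw_def quotient_def)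
    finally show ?thesis .
  qed
  ultimately show "bij_betw ((`) f) (A // r) (B // s)" by (simp add: bij_betw_def)
qed

section \<open>Coordinates on \<open>E\<close> given by \<open>\<rho>\<close> and its kernel\<close>

locale rbfh_retraction =
  fixes smul :: "'k::field \<Rightarrow> 'e::ab_group_add \<Rightarrow> 'e" and lam :: 'k
    and R E :: "('s::semigroup_mult, 'e) rbfh" and \<rho> :: "'e \<Rightarrow> 'e"
  assumes ext: "rbfh_extension smul lam R E" and ret: "linear_retraction smul R E \<rho>"
begin

abbreviation "V \<equiv> retraction_kernel E \<rho>"
abbreviation "\<Omega> \<equiv> Upsilon1 E \<rho>"
abbreviation "defs \<equiv> deformation_maps smul smul R V \<Omega>"
abbreviation "compls \<equiv> complements smul R E"

text \<open>The projection of \<open>E\<close> onto \<open>V\<close> along \<open>R\<close>; an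
  element \<open>e\<close> of \<open>E\<close> has the coordinates \<open>\<rho> e\<close> in
  \<open>R\<close> and \<open>proj e\<close> in \<open>V\<close>.\<close>

definition proj :: "'e \<Rightarrow> 'e" where "proj e = e - \<rho> e"
definition lift :: "('e \<Rightarrow> 'e) \<Rightarrow> 'e \<Rightarrow> 'e" where "lift d x = d x + x"
definition graph :: "('e \<Rightarrow> 'e) \<Rightarrow> 'e set" where "graph d = lift d ` V"

sublocale E: rbfh_algebra smul lam E using ext by (simp add: rbfh_extension_def)
sublocale R: rbfh_algebra smul lam R using ext by (simp add: rbfh_extension_def)

lemma R_subset: "a \<in> carrier R \<Longrightarrow> a \<in> carrier E"
  using ext by (auto simp: rbfh_extension_def subalgebra_def)

lemma V_subset: "x \<in> V \<Longrightarrow> x \<in> carrier E"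
  by (simp add: retraction_kernel_def)

lemma op_R:
  "a \<in> carrier R \<Longrightarrow> b \<in> carrier R \<Longrightarrow> mult R a b = mult E a b"
  "a \<in> carrier R \<Longrightarrow> rbop R w a = rbop E w a"
  "a \<in> carrier R \<Longrightarrow> twist R a = twist E a"
  using ext by (auto simp: rbfh_extension_def)

lemma op_R_closed:
  "a \<in> carrier R \<Longrightarrow> b \<in> carrier R \<Longrightarrow> mult E a b \<in> carrier R"
  "a \<in> carrier R \<Longrightarrow> rbop E w a \<in> carrier R"
  "a \<in> carrier R \<Longrightarrow> twist E a \<in> carrier R"
  using ext by (auto simp: rbfh_extension_def subalgebra_def)

lemmas op_E_closed =
  bilinear_on_mem[OF E.bilinear_mult] linear_on_mem[OF E.linear_rbop] linear_on_mem[OF E.linear_twist]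

lemma linear_mult:
  "x \<in> carrier E \<Longrightarrow> linear_on smul smul (carrier E) (carrier E) (mult E x)"
  "x \<in> carrier E \<Longrightarrow> linear_on smul smul (carrier E) (carrier E) (\<lambda>y. mult E y x)"
  using E.bilinear_mult by (auto simp: bilinear_on_def)

lemmas mult_add = linear_on_add[OF linear_mult(1)] linear_on_add[OF linear_mult(2)]

lemma closed_E:
  "x \<in> carrier E \<Longrightarrow> y \<in> carrier E \<Longrightarrow> x + y \<in> carrier E"
  "x \<in> carrier E \<Longrightarrow> smul c x \<in> carrier E"
  by (auto intro: E.subspace_add E.subspace_scale E.subspace_carrier)

lemma retract:
  "linear_on smul smul (carrier E) (carrier R) \<rho>" "a \<in> carrier R \<Longrightarrow> \<rho> a = a" "x \<in> V \<Longrightarrow> \<rho> x = 0"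
  using ret by (auto simp: linear_retraction_def retraction_kernel_def)

lemmas retract_simps =
  linear_on_mem[OF retract(1)] linear_on_add[OF retract(1)] linear_on_scale[OF retract(1)] retract(2,3)

text \<open>Values of \<open>\<rho>\<close> lie in \<open>R\<close>, where \<open>\<rho>\<close> is
  the identity, so \<open>\<rho>\<close> agrees at \<open>e\<close> and \<open>\<rho> e\<close> and
  kills their difference.\<close>

lemma proj_mem: "e \<in> carrier E \<Longrightarrow> proj e \<in> V"
  using E.linear_on_diff[OF retract(1) E.subspace_carrier, of e "\<rho> e"]
    linear_on_mem[OF retract(1), of e]
  by (simp add: proj_def retraction_kernel_def retract(2) R_subset E.subspace_diff E.subspace_carrier)

lemma linear_proj: "linear_on smul smul (carrier E) V proj"
  by (auto simp: linear_on_def proj_mem) (simp_all add: proj_def retract_simps E.scale_right_diff_distrib)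

lemma subspace_V: "E.subspace V"
  unfolding retraction_kernel_def
  using E.subspace_0[OF E.subspace_carrier] retract(2)[OF E.subspace_0[OF R.subspace_carrier]]
  by (auto simp: E.subspace_def closed_E retract_simps)

lemma extending_datum_Upsilon1: "extending_datum smul smul (carrier R) V \<Omega>"
  using extending_structure_Upsilon1[OF ext ret] by (simp add: extending_structure_def)

lemma actions_closed:
  "a \<in> carrier R \<Longrightarrow> x \<in> V \<Longrightarrow> actl \<Omega> a x \<in> V"
  "a \<in> carrier R \<Longrightarrow> x \<in> V \<Longrightarrow> actr \<Omega> x a \<in> V"
  "x \<in> V \<Longrightarrow> y \<in> V \<Longrightarrow> multV \<Omega> x y \<in> V"
  using extending_datum_Upsilon1 unfolding extending_datum_def by (auto intro: bilinear_on_mem)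

section \<open>Graphs of maps from \<open>V\<close> to \<open>R\<close>\<close>

lemma proj_lift: "d x \<in> carrier R \<Longrightarrow> x \<in> V \<Longrightarrow> proj (lift d x) = x"
  by (simp add: proj_def lift_def retract_simps R_subset V_subset)

lemma retract_lift: "d x \<in> carrier R \<Longrightarrow> x \<in> V \<Longrightarrow> \<rho> (lift d x) = d x"
  by (simp add: lift_def retract_simps R_subset V_subset)

lemma lift_mem: "d x \<in> carrier R \<Longrightarrow> x \<in> V \<Longrightarrow> lift d x \<in> carrier E"
  by (simp add: lift_def closed_E R_subset V_subset)

text \<open>A point of the graph is determined by its \<open>V\<close> coordinate. Replacing the
  existential witness by that coordinate turns closure of the graph under an operation into an
  equation.\<close>

lemma graph_iff:
  assumes "d \<in> V \<rightarrow> carrier R"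
  shows "e \<in> graph d \<longleftrightarrow> e \<in> carrier E \<and> d (proj e) = \<rho> e"
proof
  assume "e \<in> graph d"
  then obtain x where "x \<in> V" "e = lift d x" by (auto simp: graph_def)
  with assms show "e \<in> carrier E \<and> d (proj e) = \<rho> e"
    by (auto simp: lift_mem proj_lift retract_lift Pi_iff)
next
  assume e: "e \<in> carrier E \<and> d (proj e) = \<rho> e"
  then have "e = lift d (proj e)" by (simp add: lift_def) (simp add: proj_def)
  with e show "e \<in> graph d" unfolding graph_def by (blast intro: proj_mem)
qed

lemma lift_proj:
  assumes "d \<in> V \<rightarrow> carrier R" "e \<in> graph d"
  shows "lift d (proj e) = e"
  using assms by (auto simp: graph_iff lift_def) (simp add: proj_def)

lemma linear_lift:
  assumes "linear_on smul smul V (carrier R) d"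
  shows "linear_on smul smul V (carrier E) (lift d)"
  using assms lift_mem by (auto simp: linear_on_def lift_def Pi_iff E.scale_right_distrib algebra_simps)

lemma subspace_graph:
  assumes "linear_on smul smul V (carrier R) d"
  shows "E.subspace (graph d)"
proof -
  note l = linear_lift[OF assms]
  have "0 \<in> V" using E.subspace_0[OF subspace_V] .
  \<comment> \<open>Homogeneity with the scalar 0 shows that zero is lifted to zero.\<close>
  with linear_on_scale[OF l this, of 0] have "lift d 0 = 0" by simp
  moreover have "lift d x + lift d y \<in> graph d" "smul c (lift d x) \<in> graph d" if "x \<in> V" "y \<in> V" for x y c
    using that subspace_V unfolding graph_def
    by (auto simp: linear_on_add[OF l, symmetric] linear_on_scale[OF l, symmetric]
        intro!: imageI E.subspace_add E.subspace_scale)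
  ultimately show ?thesis
    using \<open>0 \<in> V\<close> unfolding E.subspace_def by (auto simp: graph_def)
qed

section \<open>Operations of \<open>E\<close> on graphs and the deformation equations\<close>

text \<open>Bilinearity expands the product into four terms, and \<open>Upsilon1\<close> is by
  definition the splitting of such terms into coordinates; the result is the unified product of
  \<open>(d x, x)\<close> and \<open>(d y, y)\<close>. The summand \<open>d x\<close> stays in
  \<open>R\<close> under the unary operations, so their \<open>V\<close> coordinates do not involve
  \<open>d\<close>.\<close>

lemma op_lift:
  assumes "x \<in> V" "y \<in> V" "d x \<in> carrier R" "d y \<in> carrier R"
  shows "proj (mult E (lift d x) (lift d y)) = actl \<Omega> (d x) y + actr \<Omega> x (d y) + multV \<Omega> x y"
    and "\<rho> (mult E (lift d x) (lift d y)) =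
      mult R (d x) (d y) + coactr \<Omega> (d x) y + coactl \<Omega> x (d y) + cocyc \<Omega> x y"
    and "proj (rbop E w (lift d x)) = PV \<Omega> w x"
    and "\<rho> (rbop E w (lift d x)) = rbop R w (d x) + Qop \<Omega> w x"
    and "proj (twist E (lift d x)) = thetaV \<Omega> x"
    and "\<rho> (twist E (lift d x)) = twist R (d x) + etaV \<Omega> x"
proof -
  note c = assms assms(1,2)[THEN V_subset] assms(3,4)[THEN R_subset]
  have "mult E (lift d x) (lift d y) =
      mult E (d x) (d y) + mult E (d x) y + mult E x (d y) + mult E x y"
    using c by (simp add: lift_def mult_add closed_E algebra_simps)
  then show "proj (mult E (lift d x) (lift d y)) = actl \<Omega> (d x) y + actr \<Omega> x (d y) + multV \<Omega> x y"
    "\<rho> (mult E (lift d x) (lift d y)) =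
      mult R (d x) (d y) + coactr \<Omega> (d x) y + coactl \<Omega> x (d y) + cocyc \<Omega> x y"
    using c by (simp_all add: proj_def Upsilon1_def retract_simps op_E_closed closed_E op_R op_R_closed
        algebra_simps)
  show "proj (rbop E w (lift d x)) = PV \<Omega> w x"
    "\<rho> (rbop E w (lift d x)) = rbop R w (d x) + Qop \<Omega> w x"
    "proj (twist E (lift d x)) = thetaV \<Omega> x"
    "\<rho> (twist E (lift d x)) = twist R (d x) + etaV \<Omega> x"
    using c by (simp_all add: lift_def linear_on_add[OF E.linear_rbop] linear_on_add[OF E.linear_twist]
        proj_def Upsilon1_def retract_simps op_E_closed op_R op_R_closed algebra_simps)
qed

text \<open>By \<open>graph_iff\<close>, an operation preserves the graph iff \<open>d\<close> sends
  the \<open>V\<close> coordinate of each result to its \<open>R\<close> coordinate. With the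
  coordinates from \<open>op_lift\<close>, these equations are the three deformation
  conditions.\<close>

lemma deformation_maps_iff:
  "d \<in> defs \<longleftrightarrow>
    d \<in> V \<rightarrow>\<^sub>E carrier R \<and> linear_on smul smul V (carrier R) d \<and> subalgebra smul E (graph d)"
proof (cases "d \<in> V \<rightarrow>\<^sub>E carrier R \<and> linear_on smul smul V (carrier R) d")
  case True
  then have d: "d \<in> V \<rightarrow> carrier R" and lin: "linear_on smul smul V (carrier R) d" by auto
  note dR = funcset_mem[OF d]
  have mul: "mult E (lift d x) (lift d y) \<in> graph d \<longleftrightarrow>
      mult R (d x) (d y) - d (multV \<Omega> x y) =
      d (actl \<Omega> (d x) y + actr \<Omega> x (d y)) - coactr \<Omega> (d x) y - coactl \<Omega> x (d y) - cocyc \<Omega> x y"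
    if xy: "x \<in> V" "y \<in> V" for x y
  proof -
    \<comment> \<open>Additivity of \<open>d\<close> isolates \<open>d (multV \<Omega> x y)\<close>,
      which the deformation equation has on its other side.\<close>
    have "d (actl \<Omega> (d x) y + actr \<Omega> x (d y) + multV \<Omega> x y) =
        d (actl \<Omega> (d x) y + actr \<Omega> x (d y)) + d (multV \<Omega> x y)"
      using xy by (intro linear_on_add[OF lin]) (simp_all add: actions_closed dR E.subspace_add subspace_V)
    then show ?thesis
      using xy by (simp add: graph_iff[OF d] op_lift dR lift_mem op_E_closed algebra_simps) metis
  qed
  \<comment> \<open>Linearity of \<open>d\<close> already makes the graph a subspace of
    \<open>E\<close>, so only closure under the operations remains, tested on lifts.\<close>
  have "subalgebra smul E (graph d) \<longleftrightarrow>
      (\<forall>x\<in>V. \<forall>y\<in>V. mult E (lift d x) (lift d y) \<in> graph d) \<and>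
      (\<forall>w. \<forall>x\<in>V. rbop E w (lift d x) \<in> graph d) \<and> (\<forall>x\<in>V. twist E (lift d x) \<in> graph d)"
    unfolding subalgebra_def using subspace_graph[OF lin] graph_iff[OF d] by (auto simp: graph_def)
  moreover have "rbop E w (lift d x) \<in> graph d \<longleftrightarrow> d (PV \<Omega> w x) = Qop \<Omega> w x + rbop R w (d x)"
    "twist E (lift d x) \<in> graph d \<longleftrightarrow> d (thetaV \<Omega> x) = etaV \<Omega> x + twist R (d x)" if "x \<in> V" for x w
    using that by (simp_all add: graph_iff[OF d] op_lift[OF that that] dR lift_mem op_E_closed algebra_simps)
  ultimately show ?thesis using True by (simp add: deformation_maps_def mul)
qed (auto simp: deformation_maps_def)

lemma deformation_mapsD:
  assumes "d \<in> defs"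
  shows "d \<in> V \<rightarrow> carrier R" "d \<in> V \<rightarrow>\<^sub>E carrier R" "linear_on smul smul V (carrier R) d"
    "subalgebra smul E (graph d)"
  using assms by (auto simp: deformation_maps_iff)

text \<open>The results lie on the graph, so \<open>lift_proj\<close> recovers them from their
  \<open>V\<close> coordinates, which \<open>op_lift\<close> provides. Thus \<open>lift d\<close>
  transports the operations of the graph to \<open>V\<close>.\<close>

lemma op_lift_deformation:
  assumes d: "d \<in> defs" and "x \<in> V" "y \<in> V"
  shows "mult E (lift d x) (lift d y) = lift d (actl \<Omega> (d x) y + actr \<Omega> x (d y) + multV \<Omega> x y)"
    and "rbop E w (lift d x) = lift d (PV \<Omega> w x)"
    and "twist E (lift d x) = lift d (thetaV \<Omega> x)"
proof -
  have "mult E (lift d x) (lift d y) \<in> graph d" "rbop E w (lift d x) \<in> graph d" "twist E (lift d x) \<in> graph d"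
    using deformation_mapsD(4)[OF d] assms by (auto simp: subalgebra_def graph_def)
  from this[THEN lift_proj[OF deformation_mapsD(1)[OF d]]] show
    "mult E (lift d x) (lift d y) = lift d (actl \<Omega> (d x) y + actr \<Omega> x (d y) + multV \<Omega> x y)"
    "rbop E w (lift d x) = lift d (PV \<Omega> w x)" "twist E (lift d x) = lift d (thetaV \<Omega> x)"
    using assms funcset_mem[OF deformation_mapsD(1)[OF d]] by (simp_all add: op_lift)
qed

section \<open>Complements as graphs of deformation maps\<close>

text \<open>Subtracting from \<open>e\<close> the graph point over \<open>proj e\<close> leaves an
  element of \<open>R\<close>, hence the sum. An element of \<open>R\<close> has \<open>V\<close>
  coordinate 0, so if it is on the graph its \<open>R\<close> coordinate is
  \<open>d 0 = 0\<close>.\<close>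

lemma graph_complement:
  assumes d: "d \<in> defs"
  shows "graph d \<in> compls"
proof -
  note dD = deformation_mapsD[OF d] and dR = funcset_mem[OF deformation_mapsD(1)[OF d]]
  have gE: "graph d \<subseteq> carrier E" using dD(4) by (simp add: subalgebra_def)
  have dec: "e = (\<rho> e - d (proj e)) + lift d (proj e)" for e
    by (simp add: lift_def proj_def)
  have "carrier E = {a + b | a b. a \<in> carrier R \<and> b \<in> graph d}"
  proof
    show "carrier E \<subseteq> {a + b | a b. a \<in> carrier R \<and> b \<in> graph d}"
    proof
      fix e assume "e \<in> carrier E"
      then have "\<rho> e - d (proj e) \<in> carrier R" "lift d (proj e) \<in> graph d"
        by (auto simp: retract_simps proj_mem dR graph_def intro: E.subspace_diff R.subspace_carrier)
      with dec[of e] show "e \<in> {a + b | a b. a \<in> carrier R \<and> b \<in> graph d}" by blast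
    qed
    show "{a + b | a b. a \<in> carrier R \<and> b \<in> graph d} \<subseteq> carrier E"
      using gE by (auto intro: closed_E R_subset)
  qed
  moreover have "a = 0" if a: "a \<in> carrier R" "a \<in> graph d" for a
  proof -
    have "proj a = 0" using a by (simp add: proj_def retract_simps)
    moreover have "d 0 = 0" using linear_on_scale[OF dD(3) E.subspace_0[OF subspace_V], of 0] by simp
    ultimately show "a = 0" using a graph_iff[OF dD(1)] by (simp add: retract_simps)
  qed
  moreover have "0 \<in> carrier R" "0 \<in> graph d"
    using E.subspace_0 R.subspace_carrier subspace_graph[OF dD(3)] by auto
  ultimately show ?thesis unfolding complements_def using dD(4) by blast
qed

text \<open>Writing \<open>x = - a + (a + x)\<close> shows that the retraction of \<open>B\<close>
  has value \<open>- a\<close> at \<open>x\<close>, and the sign in \<open>Delta1\<close> turns this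
  into \<open>a\<close>. All later values of \<open>Delta1\<close> on \<open>V\<close> come from
  this rule, without reference to \<open>THE\<close>.\<close>

lemma Delta1_eqI:
  assumes B: "B \<in> compls" and "x \<in> V" "a \<in> carrier R" "a + x \<in> B"
  shows "Delta1 R V B x = a"
proof -
  have sB: "E.subspace B" and int: "carrier R \<inter> B = {0}"
    using B by (auto simp: complements_def subalgebra_def)
  have "complement_retraction R B x = - a"
    unfolding complement_retraction_def
  proof (rule the_equality)
    show "- a \<in> carrier R \<and> (\<exists>b\<in>B. x = - a + b)"
      using assms E.subspace_neg[OF R.subspace_carrier] by (auto intro!: bexI[of _ "a + x"])
  next
    fix a' assume a': "a' \<in> carrier R \<and> (\<exists>b\<in>B. x = a' + b)"
    then obtain b where b: "b \<in> B" "x = a' + b" by auto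
    \<comment> \<open>A difference of two elements of \<open>B\<close> that also lies in
      \<open>R\<close> must vanish.\<close>
    then have "a + a' = (a + x) - b" by simp
    then have "a + a' \<in> B" using b assms E.subspace_diff[OF sB] by metis
    moreover have "a + a' \<in> carrier R" using a' assms E.subspace_add[OF R.subspace_carrier] by blast
    ultimately have "a + a' = 0" using int by blast
    then show "a' = - a" by (simp add: eq_neg_iff_add_eq_0 add.commute)
  qed
  then show ?thesis using assms by (simp add: Delta1_def)
qed

text \<open>If \<open>x = a + b\<close> along \<open>R\<close> and \<open>B\<close>, the value is
  \<open>- a\<close> and the lifted point is \<open>b\<close> itself.\<close>

lemma Delta1_mem:
  assumes B: "B \<in> compls" and x: "x \<in> V"
  shows "Delta1 R V B x \<in> carrier R" "lift (Delta1 R V B) x \<in> B"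
proof -
  have "x \<in> carrier E" using V_subset[OF x] .
  then obtain a b where ab: "a \<in> carrier R" "b \<in> B" "x = a + b"
    using B unfolding complements_def by blast
  have na: "- a \<in> carrier R" using ab(1) E.subspace_neg[OF R.subspace_carrier] by simp
  have "Delta1 R V B x = - a" using ab by (intro Delta1_eqI[OF B x na]) simp
  with na ab show "Delta1 R V B x \<in> carrier R" "lift (Delta1 R V B) x \<in> B"
    by (simp_all add: lift_def)
qed

lemma graph_Delta1:
  assumes B: "B \<in> compls"
  shows "graph (Delta1 R V B) = B"
proof
  show "graph (Delta1 R V B) \<subseteq> B" using Delta1_mem[OF B] by (auto simp: graph_def)
  show "B \<subseteq> graph (Delta1 R V B)"
  proof
    fix b assume b: "b \<in> B"
    then have bE: "b \<in> carrier E" using B by (auto simp: complements_def subalgebra_def)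
    \<comment> \<open>The element \<open>\<rho> b + proj b\<close> is \<open>b\<close>, hence lies
      in \<open>B\<close>, as \<open>Delta1_eqI\<close> requires.\<close>
    have "Delta1 R V B (proj b) = \<rho> b"
      using b by (intro Delta1_eqI[OF B proj_mem[OF bE]]) (simp_all add: retract_simps bE proj_def)
    then show "b \<in> graph (Delta1 R V B)"
      using Delta1_mem(1)[OF B] bE by (auto simp: graph_iff)
  qed
qed

text \<open>Linearity follows from uniqueness: sums and multiples of the points
  \<open>d x + x\<close> stay in \<open>B\<close>, so \<open>Delta1_eqI\<close> identifies the
  values. The equations then follow because the graph is the subalgebra \<open>B\<close>.\<close>

lemma Delta1_deformation:
  assumes B: "B \<in> compls"
  shows "Delta1 R V B \<in> defs"
proof -
  let ?d = "Delta1 R V B"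
  have sB: "E.subspace B" and sub: "subalgebra smul E B"
    using B by (auto simp: complements_def subalgebra_def)
  note m = Delta1_mem[OF B, unfolded lift_def]
  have "?d (x + y) = ?d x + ?d y" if "x \<in> V" "y \<in> V" for x y
  proof (rule Delta1_eqI[OF B])
    have "(?d x + x) + (?d y + y) \<in> B" by (rule E.subspace_add[OF sB m(2)[OF that(1)] m(2)[OF that(2)]])
    then show "?d x + ?d y + (x + y) \<in> B" by (simp add: algebra_simps)
  qed (use m that subspace_V R.subspace_carrier in \<open>auto intro: E.subspace_add\<close>)
  moreover have "?d (smul c x) = smul c (?d x)" if "x \<in> V" for x c
  proof (rule Delta1_eqI[OF B])
    have "smul c (?d x + x) \<in> B" by (rule E.subspace_scale[OF sB m(2)[OF that]])
    then show "smul c (?d x) + smul c x \<in> B" by (simp add: E.scale_right_distrib)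
  qed (use m that subspace_V R.subspace_carrier in \<open>auto intro: E.subspace_scale\<close>)
  ultimately have "linear_on smul smul V (carrier R) ?d" using m by (simp add: linear_on_def)
  moreover have "?d \<in> V \<rightarrow>\<^sub>E carrier R" using m by (auto simp: Delta1_def)
  ultimately show ?thesis by (simp add: deformation_maps_iff graph_Delta1[OF B] sub)
qed

lemma Delta1_graph:
  assumes d: "d \<in> defs"
  shows "Delta1 R V (graph d) = d"
proof
  fix x
  show "Delta1 R V (graph d) x = d x"
  \<comment> \<open>Off \<open>V\<close> both functions are extensional and take the value
    \<open>undefined\<close>.\<close>
  proof (cases "x \<in> V")
    case True
    then show ?thesis
      using deformation_mapsD(1)[OF d]
      by (intro Delta1_eqI[OF graph_complement[OF d]]) (auto simp: graph_def lift_def)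
  qed (use deformation_mapsD(2)[OF d] in \<open>auto simp: Delta1_def\<close>)
qed

lemma bij_betw_Delta1: "bij_betw (Delta1 R V) compls defs"
  by (rule bij_betw_byWitness[where f' = graph])
    (auto simp: graph_Delta1 Delta1_graph Delta1_deformation graph_complement)

section \<open>Isomorphisms of complements and equivalence of deformation maps\<close>

lemma bij_betw_lift:
  assumes "d \<in> V \<rightarrow> carrier R"
  shows "bij_betw (lift d) V (graph d)" "bij_betw proj (graph d) V"
proof -
  have "proj (lift d x) = x" if "x \<in> V" for x using funcset_mem[OF assms] that by (simp add: proj_lift)
  moreover have "lift d x \<in> graph d" if "x \<in> V" for x using that by (simp add: graph_def)
  moreover have "proj e \<in> V" if "e \<in> graph d" for e using that by (simp add: graph_iff[OF assms] proj_mem)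
  ultimately show "bij_betw (lift d) V (graph d)" "bij_betw proj (graph d) V"
    by (auto intro!: bij_betw_byWitness[of V proj "lift d"] bij_betw_byWitness[of "graph d" "lift d" proj]
        simp: lift_proj[OF assms])
qed

text \<open>
  The multiplicative condition on \<open>\<delta>\<close> in \<^const>\<open>deformation_equiv\<close> says that \<open>\<delta>\<close> is
  multiplicative for the products on \<open>V\<close> transported from the two graphs.
\<close>

lemma deformation_equiv_iff:
  assumes d: "d \<in> defs" and D: "D \<in> defs"
  shows "(d, D) \<in> deformation_equiv smul smul R V \<Omega> \<longleftrightarrow>
    (\<exists>\<delta>. linear_on smul smul V V \<delta> \<and> bij_betw \<delta> V V \<and>
      (\<forall>x\<in>V. \<forall>y\<in>V. \<delta> (actl \<Omega> (d x) y + actr \<Omega> x (d y) + multV \<Omega> x y) =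
        actl \<Omega> (D (\<delta> x)) (\<delta> y) + actr \<Omega> (\<delta> x) (D (\<delta> y)) + multV \<Omega> (\<delta> x) (\<delta> y)) \<and>
      (\<forall>w. \<forall>x\<in>V. \<delta> (PV \<Omega> w x) = PV \<Omega> w (\<delta> x)) \<and>
      (\<forall>x\<in>V. \<delta> (thetaV \<Omega> x) = thetaV \<Omega> (\<delta> x)))"
proof -
  note dR = funcset_mem[OF deformation_mapsD(1)[OF d]]
  have "\<delta> (multV \<Omega> x y) - multV \<Omega> (\<delta> x) (\<delta> y) =
        actl \<Omega> (D (\<delta> x)) (\<delta> y) + actr \<Omega> (\<delta> x) (D (\<delta> y)) - \<delta> (actl \<Omega> (d x) y) - \<delta> (actr \<Omega> x (d y))
      \<longleftrightarrow> \<delta> (actl \<Omega> (d x) y + actr \<Omega> x (d y) + multV \<Omega> x y) =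
        actl \<Omega> (D (\<delta> x)) (\<delta> y) + actr \<Omega> (\<delta> x) (D (\<delta> y)) + multV \<Omega> (\<delta> x) (\<delta> y)"
    if \<delta>: "linear_on smul smul V V \<delta>" and xy: "x \<in> V" "y \<in> V" for \<delta> x y
  proof -
    have "\<delta> (actl \<Omega> (d x) y + actr \<Omega> x (d y) + multV \<Omega> x y) =
        \<delta> (actl \<Omega> (d x) y) + \<delta> (actr \<Omega> x (d y)) + \<delta> (multV \<Omega> x y)"
      using xy by (simp add: linear_on_add[OF \<delta>] actions_closed dR E.subspace_add subspace_V)
    then show ?thesis by (simp add: algebra_simps)
  qed
  \<comment> \<open>The congruence rule makes linearity of \<open>\<delta>\<close> available when
    the multiplicative clauses are compared.\<close>
  then show ?thesis
    using d D unfolding deformation_equiv_def by (auto cong: conj_cong)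
qed

text \<open>An isomorphism \<open>\<phi>\<close> yields \<open>\<delta>\<close> as
  \<open>lift d\<close>, then \<open>\<phi>\<close>, then \<open>proj\<close>; conversely
  \<open>\<phi>\<close> is \<open>proj\<close>, then \<open>\<delta>\<close>, then
  \<open>lift D\<close>. Either way \<open>\<phi> (lift d x) = lift D (\<delta> x)\<close> on
  \<open>V\<close>, and \<open>op_lift_deformation\<close> for \<open>d\<close> and \<open>D\<close>
  translates preservation of operations between the two maps.\<close>

lemma graph_iso_iff:
  assumes d: "d \<in> defs" and D: "D \<in> defs"
  shows "(graph d, graph D) \<in> complement_iso smul R E \<longleftrightarrow>
    (d, D) \<in> deformation_equiv smul smul R V \<Omega>"
proof -
  note dD = deformation_mapsD[OF d] and DD = deformation_mapsD[OF D]
  note dR = funcset_mem[OF dD(1)] and DR = funcset_mem[OF DD(1)]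
  note opd = op_lift_deformation[OF d] and opD = op_lift_deformation[OF D]
  have cl: "actl \<Omega> (d x) y + actr \<Omega> x (d y) + multV \<Omega> x y \<in> V" "PV \<Omega> w x \<in> V" "thetaV \<Omega> x \<in> V"
    if "x \<in> V" "y \<in> V" for x y w
    \<comment> \<open>These expressions are \<open>V\<close> coordinates of elements of
      \<open>E\<close>, so \<open>proj_mem\<close> applies.\<close>
    using that by (simp_all add: op_lift(1,3,5)[of x y d, symmetric] dR lift_mem op_E_closed proj_mem)
  have clD: "actl \<Omega> (D x) y + actr \<Omega> x (D y) + multV \<Omega> x y \<in> V" if "x \<in> V" "y \<in> V" for x y
    using that by (simp add: op_lift(1)[symmetric] DR lift_mem op_E_closed proj_mem)
  have gE: "e \<in> graph d \<Longrightarrow> e \<in> carrier E" "e \<in> graph D \<Longrightarrow> e \<in> carrier E" for e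
    by (auto simp: graph_iff dD(1) DD(1))
  have prl: "x \<in> V \<Longrightarrow> proj (lift d x) = x" "x \<in> V \<Longrightarrow> proj (lift D x) = x" for x
    by (simp_all add: proj_lift dR DR)
  have lg: "x \<in> V \<Longrightarrow> lift d x \<in> graph d" "x \<in> V \<Longrightarrow> lift D x \<in> graph D" for x
    by (simp_all add: graph_def)
  show ?thesis unfolding deformation_equiv_iff[OF d D]
  proof (rule iffI; (elim exE conjE)?)
    assume "(graph d, graph D) \<in> complement_iso smul R E"
    then obtain \<phi> where bij: "bij_betw \<phi> (graph d) (graph D)"
      and lin: "linear_on smul smul (graph d) (graph D) \<phi>"
      and hm: "\<And>x y. x \<in> graph d \<Longrightarrow> y \<in> graph d \<Longrightarrow> \<phi> (mult E x y) = mult E (\<phi> x) (\<phi> y)"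
      and hr: "\<And>w x. x \<in> graph d \<Longrightarrow> \<phi> (rbop E w x) = rbop E w (\<phi> x)"
      and ht: "\<And>x. x \<in> graph d \<Longrightarrow> \<phi> (twist E x) = twist E (\<phi> x)"
      by (auto simp: complement_iso_def rbfh_isomorphic_def rbfh_hom_def restrict_alg_def)
    define \<delta> where "\<delta> x = proj (\<phi> (lift d x))" for x
    have \<phi>g: "\<phi> (lift d x) \<in> graph D" if "x \<in> V" for x
      using linear_on_mem[OF lin lg(1)[OF that]] .
    have \<delta>V: "\<delta> x \<in> V" if "x \<in> V" for x using \<phi>g that by (simp add: \<delta>_def proj_mem gE)
    have key: "\<phi> (lift d x) = lift D (\<delta> x)" if "x \<in> V" for x
      using lift_proj[OF DD(1) \<phi>g[OF that]] by (simp add: \<delta>_def)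
    have "linear_on smul smul V V \<delta>"
      using linear_on_add[OF linear_lift[OF dD(3)]] linear_on_scale[OF linear_lift[OF dD(3)]]
        linear_on_add[OF lin] linear_on_scale[OF lin] linear_on_add[OF linear_proj]
        linear_on_scale[OF linear_proj] \<delta>V \<phi>g gE lg
      unfolding linear_on_def \<delta>_def by (auto simp: Pi_iff)
    moreover have "bij_betw \<delta> V V"
      using bij_betw_trans[OF bij_betw_trans[OF bij_betw_lift(1)[OF dD(1)] bij] bij_betw_lift(2)[OF DD(1)]]
      by (simp add: comp_def \<delta>_def[abs_def])
    moreover have "\<delta> (actl \<Omega> (d x) y + actr \<Omega> x (d y) + multV \<Omega> x y) =
        actl \<Omega> (D (\<delta> x)) (\<delta> y) + actr \<Omega> (\<delta> x) (D (\<delta> y)) + multV \<Omega> (\<delta> x) (\<delta> y)"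
      if "x \<in> V" "y \<in> V" for x y
      \<comment> \<open>Only the outer \<open>\<delta>\<close>, applied to a sum, is unfolded; the
        others stay folded for \<open>key\<close>.\<close>
      unfolding \<delta>_def[of "_ + _"] opd(1)[OF that, symmetric]
      using that by (simp add: hm lg key opD \<delta>V clD prl)
    moreover have "\<delta> (PV \<Omega> w x) = PV \<Omega> w (\<delta> x)" "\<delta> (thetaV \<Omega> x) = thetaV \<Omega> (\<delta> x)" if "x \<in> V" for w x
      \<comment> \<open>The unary formulas share both membership premises of the product formula, so
        \<open>x\<close> fills both places.\<close>
      unfolding \<delta>_def[of "PV _ _ _"] \<delta>_def[of "thetaV _ _"] opd(2,3)[OF that that, symmetric]
      using that by (simp_all add: hr ht lg key opD[OF \<delta>V \<delta>V] \<delta>V cl[OF \<delta>V \<delta>V] prl)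
    ultimately show "\<exists>\<delta>. linear_on smul smul V V \<delta> \<and> bij_betw \<delta> V V \<and>
      (\<forall>x\<in>V. \<forall>y\<in>V. \<delta> (actl \<Omega> (d x) y + actr \<Omega> x (d y) + multV \<Omega> x y) =
        actl \<Omega> (D (\<delta> x)) (\<delta> y) + actr \<Omega> (\<delta> x) (D (\<delta> y)) + multV \<Omega> (\<delta> x) (\<delta> y)) \<and>
      (\<forall>w. \<forall>x\<in>V. \<delta> (PV \<Omega> w x) = PV \<Omega> w (\<delta> x)) \<and>
      (\<forall>x\<in>V. \<delta> (thetaV \<Omega> x) = thetaV \<Omega> (\<delta> x))"
      by blast
  next
    fix \<delta> assume lin: "linear_on smul smul V V \<delta>" and bij: "bij_betw \<delta> V V"
      and hm: "\<forall>x\<in>V. \<forall>y\<in>V. \<delta> (actl \<Omega> (d x) y + actr \<Omega> x (d y) + multV \<Omega> x y) =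
        actl \<Omega> (D (\<delta> x)) (\<delta> y) + actr \<Omega> (\<delta> x) (D (\<delta> y)) + multV \<Omega> (\<delta> x) (\<delta> y)"
      and hr: "\<forall>w. \<forall>x\<in>V. \<delta> (PV \<Omega> w x) = PV \<Omega> w (\<delta> x)"
      and ht: "\<forall>x\<in>V. \<delta> (thetaV \<Omega> x) = thetaV \<Omega> (\<delta> x)"
    note \<delta>V = linear_on_mem[OF lin]
    define \<phi> where "\<phi> e = lift D (\<delta> (proj e))" for e
    have key: "\<phi> (lift d x) = lift D (\<delta> x)" if "x \<in> V" for x
      using that by (simp add: \<phi>_def prl)
    have "linear_on smul smul (graph d) (graph D) \<phi>"
      using linear_on_add[OF linear_lift[OF DD(3)]] linear_on_scale[OF linear_lift[OF DD(3)]]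
        linear_on_add[OF lin] linear_on_scale[OF lin] linear_on_add[OF linear_proj]
        linear_on_scale[OF linear_proj] \<delta>V gE lg proj_mem
      unfolding linear_on_def \<phi>_def by (auto simp: Pi_iff)
    moreover have "\<phi> (mult E e f) = mult E (\<phi> e) (\<phi> f)" "\<phi> (rbop E w e) = rbop E w (\<phi> e)"
      "\<phi> (twist E e) = twist E (\<phi> e)" if ef: "e \<in> graph d" "f \<in> graph d" for e f w
    proof -
      obtain x y where xy: "x \<in> V" "y \<in> V" "e = lift d x" "f = lift d y"
        using ef unfolding graph_def by blast
      then show "\<phi> (mult E e f) = mult E (\<phi> e) (\<phi> f)" "\<phi> (rbop E w e) = rbop E w (\<phi> e)"
        "\<phi> (twist E e) = twist E (\<phi> e)"
        using hm hr ht by (simp_all add: opd[OF xy(1,2)] opD[OF \<delta>V \<delta>V] key cl)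
    qed
    moreover have "bij_betw \<phi> (graph d) (graph D)"
      using bij_betw_trans[OF bij_betw_trans[OF bij_betw_lift(2)[OF dD(1)] bij] bij_betw_lift(1)[OF DD(1)]]
      by (simp add: comp_def \<phi>_def[abs_def])
    ultimately show "(graph d, graph D) \<in> complement_iso smul R E"
      using graph_complement[OF d] graph_complement[OF D]
      by (auto simp: complement_iso_def rbfh_isomorphic_def rbfh_hom_def restrict_alg_def)
  qed
qed

text \<open>By \<open>graph_Delta1\<close>, each complement is the graph of its own deformation
  map.\<close>

lemma complement_iso_iff:
  assumes "B \<in> compls" "C \<in> compls"
  shows "(B, C) \<in> complement_iso smul R E \<longleftrightarrow>
    (Delta1 R V B, Delta1 R V C) \<in> deformation_equiv smul smul R V \<Omega>"
  using graph_iso_iff[OF Delta1_deformation Delta1_deformation, OF assms] by (simp add: graph_Delta1 assms)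

end

section \<open>The bijection of classes and the index\<close>

theorem theorem4p7:
  fixes smul :: "'k::field \<Rightarrow> 'e::ab_group_add \<Rightarrow> 'e"
    and lam :: 'k
    and R E :: "('s::semigroup_mult, 'e) rbfh"
    and \<rho> :: "'e \<Rightarrow> 'e"
    and V :: "'e set"
    and \<Omega> :: "('s, 'e, 'e) ext_datum"
  assumes "rbfh_extension smul lam R E"
    and "linear_retraction smul R E \<rho>"
    and "V = retraction_kernel E \<rho>"
    and "\<Omega> = Upsilon1 E \<rho>"
  shows "Delta1 R V \<in> complements smul R E \<rightarrow> deformation_maps smul smul R V \<Omega> \<and>
    (\<exists>\<Delta>. bij_betw \<Delta> (CH2 smul R E) (H2 smul smul R V \<Omega>) \<and>
      (\<forall>B\<in>complements smul R E.
        \<Delta> (complement_iso smul R E `` {B}) =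
        deformation_equiv smul smul R V \<Omega> `` {Delta1 R V B})) \<and>
    (rbfh_index smul R E, card_of (H2 smul smul R V \<Omega>)) \<in> ordIso"
proof -
  interpret rbfh_retraction smul lam R E \<rho>
    using assms(1,2) by unfold_locales
  note q = bij_betw_quotient_image[OF equiv_complement_iso[OF E.vector_space_axioms]
      equiv_deformation_equiv[OF E.vector_space_axioms subspace_V extending_datum_Upsilon1]
      bij_betw_Delta1 complement_iso_iff, folded CH2_def H2_def]
  \<comment> \<open>The witness for \<open>\<Delta>\<close> is direct image under
    \<open>Delta1 R V\<close>; its bijectivity also gives the equality of cardinals.\<close>
  show ?thesis
    unfolding assms(3,4) rbfh_index_def
    using Delta1_deformation q card_of_ordIsoI[OF q(1)] by blast
qed

end
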